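(* Let $f\in C(\mathbb{T})$ and let $\mathcal{Z}$ be an M-Z family for $L^\infty$. For each $n\ge1$ let $p_n$ be a trigonometric polynomial of degree at most $n$ that minimizes $\max_{z\in\mathcal{Z}(2n)}|p_n(z)-f(z)|$ among all trigonometric polynomials of degree at most $n$. Then $p_n\to f$ in $L^\infty(\mathbb{T})$ as $n\to\infty$.
   Context: $\mathbb{T}$ is the unit circle in $\mathbb{C}$; $C(\mathbb{T})$ is the space of continuous complex-valued functions on $\mathbb{T}$. $\mathcal{P}_n$ is the space of holomorphic polynomials (complex coefficients, one variable) of degree at most $n$. A trigonometric polynomial of degree at most $n$ is a function on $\mathbb{T}$ of the form $a_0+\sum_{i=1}^n(a_iz^i+b_i\bar z^i)$ with complex coefficients. A triangular family is a collection $\mathcal{Z}=\{z_{n,j}\}$, $n\ge 0$, $0\le j\le m_n$, of points $z_{n,j}\in\mathbb{T}$; its $n$-th generation is $\mathcal{Z}(n)=\{z_{n,0},\dots,z_{n,m_n}\}$. $\mathcal{Z}$ is an M-Z (Marcinkiewicz-Zygmund) family for $L^\infty$ if there is a constant $C>0$ such that for all $n$ and all $q\in\mathcal{P}_n$, $\sup_{|z|=1}|q(z)|\le C\sup_{0\le j\le m_n}|q(z_{n,j})|$. *)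

theory Defs
  imports "HOL-Analysis.Analysis" "HOL-Computational_Algebra.Polynomial"
begin

abbreviation unit_circle :: "complex set" where
  "unit_circle \<equiv> sphere 0 1"

(* Functions on the circle are represented by total functions on the complex plane;
   only their values on the circle are ever constrained. *)
definition trig_poly :: "nat \<Rightarrow> (complex \<Rightarrow> complex) \<Rightarrow> bool" where
  "trig_poly n p \<longleftrightarrow>
    (\<exists>a b :: nat \<Rightarrow> complex. \<forall>z\<in>unit_circle.
      p z = a 0 + (\<Sum>i=1..n. a i * z ^ i + b i * cnj z ^ i))"

(* The real-valued supremum is meaningful only for functions bounded on the circle.
   For functions continuous on the circle it is the norm of L-infinity. *)
definition circle_sup_norm :: "(complex \<Rightarrow> complex) \<Rightarrow> real" where
  "circle_sup_norm g = (SUP z\<in>unit_circle. cmod (g z))"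

(* The points z n j are relevant for j \<le> m n only, and need not be distinct. *)
definition triangular_family :: "(nat \<Rightarrow> nat) \<Rightarrow> (nat \<Rightarrow> nat \<Rightarrow> complex) \<Rightarrow> bool" where
  "triangular_family m z \<longleftrightarrow> (\<forall>n. \<forall>j\<le>m n. z n j \<in> unit_circle)"

definition generation :: "(nat \<Rightarrow> nat) \<Rightarrow> (nat \<Rightarrow> nat \<Rightarrow> complex) \<Rightarrow> nat \<Rightarrow> complex set" where
  "generation m z n = z n ` {0..m n}"

definition MZ_family :: "(nat \<Rightarrow> nat) \<Rightarrow> (nat \<Rightarrow> nat \<Rightarrow> complex) \<Rightarrow> bool" where
  "MZ_family m z \<longleftrightarrow> triangular_family m z \<and>
    (\<exists>C>0. \<forall>n. \<forall>q :: complex poly. degree q \<le> n \<longrightarrow>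
      circle_sup_norm (poly q) \<le> C * (SUP j\<in>{0..m n}. cmod (poly q (z n j))))"

end

theory Submission
  imports Defs
begin

text \<open>Multiplication by \<open>z ^ n\<close> identifies the trigonometric polynomials of degree at most \<open>n\<close> on the
  circle with the holomorphic polynomials of degree at most \<open>2 * n\<close> and preserves absolute values,
  so the sampling inequality passes to trigonometric polynomials on the generation \<open>2 * n\<close>.
  By Weierstrass some trigonometric polynomial \<open>t\<close> is uniformly \<open>\<epsilon>\<close>-close to \<open>f\<close>. For large \<open>n\<close>
  it competes with \<open>p n\<close>, so both are \<open>\<epsilon>\<close>-close to \<open>f\<close> on the sample points, and sampling bounds
  \<open>p n - t\<close> by \<open>2 * C * \<epsilon>\<close> on the whole circle.\<close>

section \<open>Trigonometric polynomials as shifted holomorphic polynomials\<close>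

lemma unit_circle_mult_cnj:
  assumes "w \<in> unit_circle"
  shows "w * cnj w = 1"
  using assms by (simp add: complex_norm_square [symmetric])

lemma unit_circle_power_mult_cnj:
  assumes "w \<in> unit_circle"
  shows "w ^ k * cnj w ^ k = 1"
  using unit_circle_mult_cnj [OF assms] by (simp flip: power_mult_distrib)

text \<open>On the circle \<open>cnj w\<close> is the inverse of \<open>w\<close>, so the factor
  \<open>w ^ n\<close> shifts the exponents from \<open>-n..n\<close> to \<open>0..2 * n\<close>.
  This form lets products and changes of degree be handled by polynomial algebra.\<close>

lemma trig_poly_iff_poly:
  "trig_poly n p \<longleftrightarrow>
    (\<exists>q. degree q \<le> 2 * n \<and> (\<forall>w\<in>unit_circle. w ^ n * p w = poly q w))"
proof
  assume "trig_poly n p"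
  then obtain a b where p: "\<And>w. w \<in> unit_circle \<Longrightarrow>
      p w = a 0 + (\<Sum>i=1..n. a i * w ^ i + b i * cnj w ^ i)"
    unfolding trig_poly_def by blast
  define q where "q = monom (a 0) n + (\<Sum>i=1..n. monom (a i) (n + i) + monom (b i) (n - i))"
  have "degree q \<le> 2 * n"
    unfolding q_def
    by (intro degree_add_le degree_sum_le order.trans [OF degree_monom_le]) auto
  moreover have "w ^ n * p w = poly q w" if w: "w \<in> unit_circle" for w
  proof -
    have "w ^ n * cnj w ^ i = w ^ (n - i)" if "i \<le> n" for i
    proof -
      have "w ^ n = w ^ (n - i) * w ^ i"
        using that by (simp flip: power_add)
      then show ?thesis
        using unit_circle_power_mult_cnj [OF w, of i] by (simp add: mult.assoc)
    qed
    then have "w ^ n * (b i * cnj w ^ i) = b i * w ^ (n - i)" if "i \<le> n" for i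
      using that by (simp add: mult.left_commute)
    then show ?thesis
      by (auto simp: p [OF w] q_def poly_sum poly_monom distrib_left sum_distrib_left power_add
          intro!: sum.cong)
  qed
  ultimately show "\<exists>q. degree q \<le> 2 * n \<and> (\<forall>w\<in>unit_circle. w ^ n * p w = poly q w)"
    by blast
next
  assume "\<exists>q. degree q \<le> 2 * n \<and> (\<forall>w\<in>unit_circle. w ^ n * p w = poly q w)"
  then obtain q where deg: "degree q \<le> 2 * n"
    and q: "\<And>w. w \<in> unit_circle \<Longrightarrow> w ^ n * p w = poly q w"
    by blast
  \<comment> \<open>Undoing the shift, the coefficient of exponent \<open>k\<close> in
    \<open>q\<close> belongs to frequency \<open>k - n\<close>. The index \<open>n + 0\<close>
    matches the term \<open>a 0\<close> of the definition for
    \<open>a i = coeff q (n + i)\<close>.\<close>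
  have "p w = coeff q (n + 0) + (\<Sum>i=1..n. coeff q (n + i) * w ^ i + coeff q (n - i) * cnj w ^ i)"
    if w: "w \<in> unit_circle" for w
  proof -
    have cancel: "cnj w ^ k * (w ^ k * x) = x" for k x
      using unit_circle_power_mult_cnj [OF w, of k] by (metis mult.assoc mult.commute mult_1)
    \<comment> \<open>Truncated subtraction forces two cases: exponents from \<open>n\<close>
      upwards leave a power of \<open>w\<close>, those up to \<open>n\<close> a power of
      \<open>cnj w\<close>.\<close>
    have up: "cnj w ^ n * w ^ k = w ^ (k - n)" if "n \<le> k" for k
      using cancel [of n "w ^ (k - n)"] that by (simp flip: power_add)
    have down: "cnj w ^ n * w ^ k = cnj w ^ (n - k)" if "k \<le> n" for k
    proof -
      have "cnj w ^ n = cnj w ^ k * cnj w ^ (n - k)"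
        using that by (simp flip: power_add)
      then show ?thesis
        using cancel [of k "cnj w ^ (n - k)"] by (simp only: mult_ac)
    qed
    have "p w = cnj w ^ n * (w ^ n * p w)"
      by (rule cancel [symmetric])
    also have "\<dots> = cnj w ^ n * (\<Sum>k\<le>2 * n. coeff q k * w ^ k)"
      by (subst q [OF w], subst poly_as_sum_of_monoms' [OF deg, symmetric])
        (simp add: poly_sum poly_monom)
    also have "\<dots> = (\<Sum>k\<le>2 * n. coeff q k * (cnj w ^ n * w ^ k))"
      by (simp add: sum_distrib_left mult_ac)
    \<comment> \<open>Split into zero, negative and positive frequencies.\<close>
    also have "{..2 * n} = insert n ({..<n} \<union> {n<..2 * n})"
      by auto
    also have "(\<Sum>k\<in>\<dots>. coeff q k * (cnj w ^ n * w ^ k)) =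
        coeff q n + (\<Sum>k<n. coeff q k * (cnj w ^ n * w ^ k)) +
        (\<Sum>k\<in>{n<..2 * n}. coeff q k * (cnj w ^ n * w ^ k))"
      using up [of n] by (subst sum.insert) (auto intro: sum.union_disjoint)
    also have "(\<Sum>k<n. coeff q k * (cnj w ^ n * w ^ k)) = (\<Sum>i=1..n. coeff q (n - i) * cnj w ^ i)"
      by (rule sum.reindex_bij_witness [where i = "\<lambda>i. n - i" and j = "\<lambda>i. n - i"])
        (auto simp: down)
    also have "(\<Sum>k\<in>{n<..2 * n}. coeff q k * (cnj w ^ n * w ^ k)) =
        (\<Sum>i=1..n. coeff q (n + i) * w ^ i)"
      by (rule sum.reindex_bij_witness [where i = "\<lambda>i. n + i" and j = "\<lambda>i. i - n"])
        (auto simp: up)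
    finally show ?thesis
      by (simp add: sum.distrib add_ac)
  qed
  then show "trig_poly n p"
    unfolding trig_poly_def
    by (intro exI [of _ "\<lambda>i. coeff q (n + i)"] exI [of _ "\<lambda>i. coeff q (n - i)"]) simp
qed

section \<open>Closure properties\<close>

lemma trig_poly_mono:
  assumes "trig_poly n p" "n \<le> k"
  shows "trig_poly k p"
proof -
  obtain q where q: "degree q \<le> 2 * n" "\<And>w. w \<in> unit_circle \<Longrightarrow> w ^ n * p w = poly q w"
    using assms(1) unfolding trig_poly_iff_poly by blast
  \<comment> \<open>The larger shift \<open>w ^ k\<close> costs an extra factor
    \<open>w ^ (k - n)\<close>; the degree is at most \<open>(k - n) + 2 * n = k + n\<close>, hence
    at most \<open>2 * k\<close>.\<close>
  have "degree (monom 1 (k - n) * q) \<le> 2 * k"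
    using q(1) assms(2) by (intro order.trans [OF degree_mult_le]) (simp add: degree_monom_eq)
  moreover have "w ^ k * p w = poly (monom 1 (k - n) * q) w" if "w \<in> unit_circle" for w
  proof -
    have "w ^ k = w ^ (k - n) * w ^ n"
      using assms(2) by (simp flip: power_add)
    then show ?thesis
      by (simp add: poly_monom mult.assoc flip: q(2) [OF that])
  qed
  ultimately show ?thesis
    unfolding trig_poly_iff_poly by blast
qed

lemma trig_poly_add:
  assumes "trig_poly n p" "trig_poly n q"
  shows "trig_poly n (\<lambda>w. p w + q w)"
proof -
  obtain P Q where "degree P \<le> 2 * n" "\<forall>w\<in>unit_circle. w ^ n * p w = poly P w"
    "degree Q \<le> 2 * n" "\<forall>w\<in>unit_circle. w ^ n * q w = poly Q w"
    using assms unfolding trig_poly_iff_poly by blast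
  then show ?thesis
    unfolding trig_poly_iff_poly
    by (intro exI [of _ "P + Q"]) (simp add: degree_add_le distrib_left)
qed

lemma trig_poly_mult:
  assumes "trig_poly n p" "trig_poly k q"
  shows "trig_poly (n + k) (\<lambda>w. p w * q w)"
proof -
  obtain P Q where deg: "degree P \<le> 2 * n" "degree Q \<le> 2 * k"
    and PQ: "\<And>w. w \<in> unit_circle \<Longrightarrow> w ^ n * p w = poly P w"
      "\<And>w. w \<in> unit_circle \<Longrightarrow> w ^ k * q w = poly Q w"
    using assms unfolding trig_poly_iff_poly by blast
  have "degree (P * Q) \<le> 2 * (n + k)"
    using deg by (intro order.trans [OF degree_mult_le]) simp
  moreover have "w ^ (n + k) * (p w * q w) = poly (P * Q) w" if "w \<in> unit_circle" for w
    by (simp add: power_add mult_ac flip: PQ [OF that])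
  ultimately show ?thesis
    unfolding trig_poly_iff_poly by blast
qed

lemma trig_poly_const: "trig_poly 0 (\<lambda>w. c)"
  unfolding trig_poly_def by auto

lemma trig_poly_diff:
  assumes "trig_poly n p" "trig_poly n q"
  shows "trig_poly n (\<lambda>w. p w - q w)"
  using trig_poly_add [OF assms(1) trig_poly_mult [OF trig_poly_const [of "-1"] assms(2), simplified]]
  by simp

section \<open>Uniform density in the continuous functions\<close>

lemma trig_poly_bounded_linear:
  fixes h :: "complex \<Rightarrow> real"
  assumes "bounded_linear h"
  shows "trig_poly 1 (\<lambda>w. of_real (h w))"
proof -
  interpret bounded_linear h by fact
  \<comment> \<open>Substitute \<open>Re w = (w + cnj w) / 2\<close> and
    \<open>Im w = (w - cnj w) / (2 * \<i>)\<close> into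
    \<open>h w = Re w * h 1 + Im w * h \<i>\<close> and collect terms.\<close>
  define c d where "c = (h 1 - \<i> * h \<i>) / 2" and "d = (h 1 + \<i> * h \<i>) / 2"
  have "of_real (h w) = c * w + d * cnj w" for w
  proof -
    have "h w = h (Re w *\<^sub>R 1 + Im w *\<^sub>R \<i>)"
      by (rule arg_cong [where f = h]) (simp add: complex_eq_iff)
    also have "\<dots> = Re w * h 1 + Im w * h \<i>"
      by (simp only: add scaleR real_scaleR_def)
    finally show ?thesis
      by (simp add: complex_eq_iff field_simps c_def d_def)
  qed
  then show ?thesis
    unfolding trig_poly_def
    by (intro exI [of _ "\<lambda>i. if i = 0 then 0 else c"] exI [of _ "\<lambda>i. d"]) simp
qed

text \<open>Real polynomial functions are generated from linear functionals and constants by sums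
  and products; sums are formed in the larger of the two degrees, products add degrees.\<close>

lemma trig_poly_real_polynomial_function:
  fixes h :: "complex \<Rightarrow> real"
  assumes "real_polynomial_function h"
  shows "\<exists>n. trig_poly n (\<lambda>w. of_real (h w))"
  using assms
proof (induction rule: real_polynomial_function.induct)
  case (linear h)
  then show ?case
    using trig_poly_bounded_linear by blast
next
  case (const c)
  then show ?case
    using trig_poly_const by blast
next
  case (add h k)
  then obtain n n' where "trig_poly n (\<lambda>w. of_real (h w))" "trig_poly n' (\<lambda>w. of_real (k w))"
    by blast
  then have "trig_poly (max n n') (\<lambda>w. of_real (h w) + of_real (k w))"
    by (intro trig_poly_add) (auto elim: trig_poly_mono)
  then show ?case
    by auto
next
  case (mult h k)
  then show ?case
    using trig_poly_mult by fastforce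
qed

lemma trig_poly_polynomial_function:
  fixes g :: "complex \<Rightarrow> complex"
  assumes "polynomial_function g"
  shows "\<exists>n. trig_poly n g"
proof -
  have "real_polynomial_function (\<lambda>w. Re (g w))" "real_polynomial_function (\<lambda>w. Im (g w))"
    using assms bounded_linear_Re bounded_linear_Im by (auto simp: polynomial_function_def o_def)
  then obtain n k where n: "trig_poly n (\<lambda>w. of_real (Re (g w)))"
    and k: "trig_poly k (\<lambda>w. of_real (Im (g w)))"
    using trig_poly_real_polynomial_function by blast
  have "trig_poly k (\<lambda>w. \<i> * of_real (Im (g w)))"
    using trig_poly_mult [OF trig_poly_const k] by simp
  with n have "trig_poly (max n k) (\<lambda>w. of_real (Re (g w)) + \<i> * of_real (Im (g w)))"
    by (intro trig_poly_add) (auto elim: trig_poly_mono)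
  then show ?thesis
    by (auto simp flip: complex_eq)
qed

text \<open>Stone-Weierstrass supplies a polynomial in \<open>Re w\<close> and \<open>Im w\<close>,
  which on the circle is a trigonometric polynomial of some degree.\<close>

lemma trig_poly_dense:
  assumes "continuous_on unit_circle f" "0 < \<epsilon>"
  obtains n t where "trig_poly n t" "\<And>w. w \<in> unit_circle \<Longrightarrow> cmod (t w - f w) < \<epsilon>"
proof -
  obtain g where "polynomial_function g" "\<And>w. w \<in> unit_circle \<Longrightarrow> cmod (f w - g w) < \<epsilon>"
    using Stone_Weierstrass_polynomial_function [OF compact_sphere assms] by blast
  then show thesis
    using that trig_poly_polynomial_function by (metis norm_minus_commute)
qed

section \<open>Supremum norm and sampling\<close>

lemma circle_sup_norm_le:
  assumes "\<And>w. w \<in> unit_circle \<Longrightarrow> cmod (g w) \<le> B"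
  shows "circle_sup_norm g \<le> B"
  unfolding circle_sup_norm_def by (rule cSUP_least) (use assms in simp_all)

lemma cmod_le_circle_sup_norm:
  assumes "continuous_on unit_circle g" "w \<in> unit_circle"
  shows "cmod (g w) \<le> circle_sup_norm g"
proof -
  \<comment> \<open>Compactness gives the boundedness that makes the real supremum an upper
    bound.\<close>
  have "compact ((\<lambda>w. cmod (g w)) ` unit_circle)"
    using assms(1) by (intro compact_continuous_image continuous_on_norm compact_sphere)
  then show ?thesis
    unfolding circle_sup_norm_def
    by (intro cSUP_upper assms(2) bounded_imp_bdd_above compact_imp_bounded)
qed

text \<open>The constant is fixed before \<open>n\<close>, \<open>q\<close> and \<open>B\<close>, so
  one \<open>C\<close> serves all degrees. An arbitrary bound \<open>B\<close> on the sample values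
  replaces their supremum.\<close>

lemma MZ_family_trig_poly_bound:
  assumes "MZ_family m z"
  obtains C where "0 < C"
    "\<And>n q B w. \<lbrakk>trig_poly n q; \<And>v. v \<in> generation m z (2 * n) \<Longrightarrow> cmod (q v) \<le> B; w \<in> unit_circle\<rbrakk>
      \<Longrightarrow> cmod (q w) \<le> C * B"
proof -
  obtain C where C: "0 < C"
    and MZ: "\<And>n q. degree q \<le> n \<Longrightarrow>
      circle_sup_norm (poly q) \<le> C * (SUP j\<in>{0..m n}. cmod (poly q (z n j)))"
    using assms unfolding MZ_family_def by blast
  have circle: "z n j \<in> unit_circle" if "j \<le> m n" for n j
    using assms that unfolding MZ_family_def triangular_family_def by blast
  have "cmod (q w) \<le> C * B"
    if q: "trig_poly n q" and B: "\<And>v. v \<in> generation m z (2 * n) \<Longrightarrow> cmod (q v) \<le> B"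
      and w: "w \<in> unit_circle" for n q B w
  proof -
    obtain Q where deg: "degree Q \<le> 2 * n"
      and Q: "\<And>w. w \<in> unit_circle \<Longrightarrow> w ^ n * q w = poly Q w"
      using q unfolding trig_poly_iff_poly by blast
    have norm_eq: "cmod (q w) = cmod (poly Q w)" if "w \<in> unit_circle" for w
      using that by (simp add: norm_mult norm_power flip: Q)
    have "cmod (q w) \<le> circle_sup_norm (poly Q)"
      unfolding norm_eq [OF w] by (intro cmod_le_circle_sup_norm w continuous_intros)
    also have "\<dots> \<le> C * (SUP j\<in>{0..m (2 * n)}. cmod (poly Q (z (2 * n) j)))"
      by (rule MZ [OF deg])
    also have "\<dots> \<le> C * B"
      \<comment> \<open>By \<open>norm_eq\<close>, \<open>B\<close> also bounds
        \<open>poly Q\<close> at the sample points.\<close>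
      using C B circle
      by (intro mult_left_mono cSUP_least) (auto simp: generation_def simp flip: norm_eq)
    finally show ?thesis .
  qed
  with C show thesis
    using that by blast
qed

section \<open>Convergence of the discrete minimizers\<close>

theorem proposition1:
  fixes f :: "complex \<Rightarrow> complex"
    and m :: "nat \<Rightarrow> nat"
    and z :: "nat \<Rightarrow> nat \<Rightarrow> complex"
    and p :: "nat \<Rightarrow> complex \<Rightarrow> complex"
  assumes "continuous_on unit_circle f"
    and "MZ_family m z"
    and "\<And>n. n \<ge> 1 \<Longrightarrow>
      is_arg_min (\<lambda>q. MAX w\<in>generation m z (2 * n). cmod (q w - f w)) (trig_poly n) (p n)"
  shows "(\<lambda>n. circle_sup_norm (\<lambda>w. p n w - f w)) \<longlonglongrightarrow> 0"
proof -
  obtain C where C: "0 < C"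
    and sampling: "\<And>n q B w. \<lbrakk>trig_poly n q;
      \<And>v. v \<in> generation m z (2 * n) \<Longrightarrow> cmod (q v) \<le> B; w \<in> unit_circle\<rbrakk> \<Longrightarrow> cmod (q w) \<le> C * B"
    using MZ_family_trig_poly_bound [OF assms(2)] by blast
  have gen: "finite (generation m z k)" "generation m z k \<noteq> {}" "generation m z k \<subseteq> unit_circle" for k
    using assms(2) by (auto simp: generation_def MZ_family_def triangular_family_def)
  \<comment> \<open>The constant adds \<open>2 * C * \<epsilon>\<close> for the distance from
    \<open>p n\<close> to \<open>t\<close> and \<open>\<epsilon>\<close> for that from
    \<open>t\<close> to \<open>f\<close>.\<close>
  have approx: "\<exists>N. \<forall>n\<ge>N. \<forall>w\<in>unit_circle. cmod (p n w - f w) \<le> (2 * C + 1) * \<epsilon>"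
    if \<epsilon>: "0 < \<epsilon>" for \<epsilon>
  proof -
    obtain N t where t: "trig_poly N t" and tf: "\<And>w. w \<in> unit_circle \<Longrightarrow> cmod (t w - f w) < \<epsilon>"
      using trig_poly_dense [OF assms(1) \<epsilon>] by blast
    have "cmod (p n w - f w) \<le> (2 * C + 1) * \<epsilon>"
      \<comment> \<open>Minimality is assumed from \<open>n = 1\<close> on, and \<open>t\<close> is
        admissible from \<open>n = N\<close> on.\<close>
      if n: "max 1 N \<le> n" and w: "w \<in> unit_circle" for n w
    proof -
      let ?G = "generation m z (2 * n)"
      have tn: "trig_poly n t"
        using trig_poly_mono [OF t] n by simp
      have pn: "trig_poly n (p n)"
        and min: "(MAX w\<in>?G. cmod (p n w - f w)) \<le> (MAX w\<in>?G. cmod (t w - f w))"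
        using assms(3) [of n] n tn by (auto simp: is_arg_min_def not_less)
      have tf_gen: "cmod (t v - f v) \<le> \<epsilon>" if "v \<in> ?G" for v
        using tf gen(3) that by (meson less_imp_le subsetD)
      have "cmod (p n v - t v) \<le> 2 * \<epsilon>" if v: "v \<in> ?G" for v
      proof -
        have "cmod (p n v - f v) \<le> (MAX w\<in>?G. cmod (p n w - f w))"
          using gen v by (intro Max_ge) auto
        also note min
        also have "(MAX w\<in>?G. cmod (t w - f w)) \<le> \<epsilon>"
          using gen tf_gen by (intro Max.boundedI) auto
        finally show ?thesis
          using tf_gen [OF v] norm_triangle_ineq4 [of "p n v - f v" "t v - f v"] by simp
      qed
      then have "cmod (p n w - t w) \<le> C * (2 * \<epsilon>)"
        by (rule sampling [OF trig_poly_diff [OF pn tn] _ w])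
      with norm_triangle_ineq [of "p n w - t w" "t w - f w"] tf [OF w] show ?thesis
        by (simp add: algebra_simps)
    qed
    then show ?thesis
      by blast
  qed
  show ?thesis
  proof (rule LIMSEQ_I)
    fix r :: real
    assume r: "0 < r"
    \<comment> \<open>Aiming at \<open>r / 2\<close> keeps the final inequality strict after passing
      to the supremum.\<close>
    define \<epsilon> where "\<epsilon> = r / 2 / (2 * C + 1)"
    have "0 < 2 * C + 1"
      using C by simp
    then have "0 < \<epsilon>" and "(2 * C + 1) * \<epsilon> = r / 2"
      using r by (simp_all add: \<epsilon>_def divide_simps)
    then obtain N where N: "\<And>n w. \<lbrakk>N \<le> n; w \<in> unit_circle\<rbrakk> \<Longrightarrow> cmod (p n w - f w) \<le> r / 2"
      using approx [of \<epsilon>] by metis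
    have "norm (circle_sup_norm (\<lambda>w. p n w - f w) - 0) < r" if n: "N \<le> n" for n
    proof -
      have "circle_sup_norm (\<lambda>w. p n w - f w) \<le> r / 2"
        using N [OF n] by (rule circle_sup_norm_le)
      \<comment> \<open>The uniform bound makes the supremum dominate the nonnegative value at the
        point 1.\<close>
      moreover have "bdd_above ((\<lambda>w. cmod (p n w - f w)) ` unit_circle)"
        using N [OF n] by (rule bdd_aboveI2)
      then have "0 \<le> circle_sup_norm (\<lambda>w. p n w - f w)"
        unfolding circle_sup_norm_def by (intro cSUP_upper2 [where x = 1]) auto
      ultimately show ?thesis
        using r by simp
    qed
    then show "\<exists>N. \<forall>n\<ge>N. norm (circle_sup_norm (\<lambda>w. p n w - f w) - 0) < r"
      by blast
  qed
qed

end
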